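(* Let $\varphi:\mathbb{R}\to\mathbb{R}$ be a polynomial such that $C_{\psi,\varphi}$ is a weakly supercyclic operator on $\mathscr{S}(\mathbb{R})$ for some $\psi\in\mathscr{O}_M(\mathbb{R})$. Then $\varphi(x)=x+b$ with some $b\in\mathbb{R}$, $b\ne0$.
   Context: $\mathscr{S}(\mathbb{R})$ is the Schwartz space of complex-valued rapidly decreasing smooth functions with its standard Fréchet topology. $\mathscr{O}_M(\mathbb{R})$ is the set of all $\psi\in C^\infty(\mathbb{R})$ (complex-valued) such that for every $\gamma\in\mathbb{N}_0$ there is $r>0$ with $\sup_x(1+|x|)^{-r}|\psi^{(\gamma)}(x)|<\infty$. $C_{\psi,\varphi}f=\psi\cdot(f\circ\varphi)$. That $C_{\psi,\varphi}$ is weakly supercyclic on $\mathscr{S}(\mathbb{R})$ means that it maps $\mathscr{S}(\mathbb{R})$ (continuously) into itself and there is $f\in\mathscr{S}(\mathbb{R})$ such that $\{\lambda C_{\psi,\varphi}^nf:\lambda\in\mathbb{C},n\in\mathbb{N}\}$ is dense in $\mathscr{S}(\mathbb{R})$ for the weak topology. *)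

theory Defs
  imports "HOL-Analysis.Analysis" "HOL-Computational_Algebra.Polynomial"
begin

definition nderiv :: "nat \<Rightarrow> (real \<Rightarrow> complex) \<Rightarrow> real \<Rightarrow> complex" where
  "nderiv n f = ((\<lambda>g x. vector_derivative g (at x)) ^^ n) f"

definition smooth :: "(real \<Rightarrow> complex) \<Rightarrow> bool" where
  "smooth f \<longleftrightarrow> (\<forall>n x. nderiv n f differentiable (at x))"

definition schwartz_space :: "(real \<Rightarrow> complex) set" where
  "schwartz_space = {f. smooth f \<and>
     (\<forall>k n. bdd_above (range (\<lambda>x. (1 + \<bar>x\<bar>) ^ k * norm (nderiv n f x))))}"

definition schwartz_seminorm :: "nat \<Rightarrow> nat \<Rightarrow> (real \<Rightarrow> complex) \<Rightarrow> real" where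
  "schwartz_seminorm k n f = (SUP x. (1 + \<bar>x\<bar>) ^ k * norm (nderiv n f x))"

text \<open>The standard topology of the Schwartz space, with the open balls of the individual
  seminorms (around arbitrary centres) as a subbasis.\<close>

definition schwartz_topology :: "(real \<Rightarrow> complex) topology" where
  "schwartz_topology = topology_generated_by
     {{g \<in> schwartz_space. schwartz_seminorm k n (\<lambda>x. g x - f x) < \<epsilon>} | f k n \<epsilon>.
        f \<in> schwartz_space \<and> 0 < \<epsilon>}"

text \<open>The topological dual. Its elements are total functions on \<^typ>\<open>real \<Rightarrow> complex\<close>, of which only the
  values on the Schwartz space matter.\<close>

definition schwartz_dual :: "((real \<Rightarrow> complex) \<Rightarrow> complex) set" where
  "schwartz_dual = {u. continuous_map schwartz_topology euclidean u \<and>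
     (\<forall>f \<in> schwartz_space. \<forall>g \<in> schwartz_space. u (\<lambda>x. f x + g x) = u f + u g) \<and>
     (\<forall>c. \<forall>f \<in> schwartz_space. u (\<lambda>x. c * f x) = c * u f)}"

definition weak_schwartz_topology :: "(real \<Rightarrow> complex) topology" where
  "weak_schwartz_topology = topology_generated_by
     {{f \<in> schwartz_space. u f \<in> U} | u U. u \<in> schwartz_dual \<and> open U}"

definition multiplier_space :: "(real \<Rightarrow> complex) set" where
  "multiplier_space = {\<psi>. smooth \<psi> \<and>
     (\<forall>n. \<exists>r>0. bdd_above (range (\<lambda>x. (1 + \<bar>x\<bar>) powr (- r) * norm (nderiv n \<psi> x))))}"

definition weighted_composition ::
  "(real \<Rightarrow> complex) \<Rightarrow> (real \<Rightarrow> real) \<Rightarrow> (real \<Rightarrow> complex) \<Rightarrow> real \<Rightarrow> complex" where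
  "weighted_composition \<psi> \<phi> f = (\<lambda>x. \<psi> x * f (\<phi> x))"

text \<open>Linearity of \<open>T\<close> is not demanded explicitly, since it is automatic for weighted composition
  operators. Note that \<^const>\<open>continuous_map\<close> includes that \<open>T\<close> maps the Schwartz space into itself.
  Orbits start with the first iterate.\<close>

definition weakly_supercyclic :: "((real \<Rightarrow> complex) \<Rightarrow> (real \<Rightarrow> complex)) \<Rightarrow> bool" where
  "weakly_supercyclic T \<longleftrightarrow>
     continuous_map schwartz_topology schwartz_topology T \<and>
     (\<exists>f \<in> schwartz_space.
        weak_schwartz_topology closure_of {(\<lambda>x. c * (T ^^ n) f x) | c n. n \<ge> 1} = schwartz_space)"

lemma topspace_schwartz_topology: "topspace schwartz_topology = schwartz_space"
proof -
  have "f \<in> topspace schwartz_topology" if f: "f \<in> schwartz_space" for f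
  proof -
    have "nderiv n (\<lambda>x. 0) = (\<lambda>x. 0)" for n
      by (induction n) (simp_all add: nderiv_def)
    then have "f \<in> {g \<in> schwartz_space. schwartz_seminorm 0 0 (\<lambda>x. g x - f x) < 1}"
      using f by (simp add: schwartz_seminorm_def)
    then show ?thesis
      unfolding schwartz_topology_def topology_generated_by_topspace
      using f zero_less_one by blast
  qed
  then show ?thesis
    by (auto simp: schwartz_topology_def)
qed

lemma topspace_weak_schwartz_topology: "topspace weak_schwartz_topology = schwartz_space"
proof -
  have "(\<lambda>_. 0) \<in> schwartz_dual"
    by (simp add: schwartz_dual_def)
  then have "schwartz_space \<subseteq> topspace weak_schwartz_topology"
    unfolding weak_schwartz_topology_def topology_generated_by_topspace
    using open_UNIV by blast
  then show ?thesis
    by (auto simp: weak_schwartz_topology_def)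
qed

end

(* Weak density of the projective orbit passes to the pairs (g x, g' x) of its members, which
   must be dense in C^2 because evaluations of derivatives are continuous functionals. At a zero
   of phi' these pairs satisfy a linear relation, and at a fixed point of phi they stay in a
   proper closed real hypersurface. Hence neither phi' nor phi - id has a zero; if phi has
   degree at least 2, one of these two polynomials has odd degree and so a real root. *)

theory Submission
  imports Defs
begin

section \<open>Derivatives and linear combinations of Schwartz functions\<close>

lemma nderiv_0 [simp]: "nderiv 0 f = f"
  by (simp add: nderiv_def)

lemma nderiv_Suc: "nderiv (Suc n) f = (\<lambda>x. vector_derivative (nderiv n f) (at x))"
  by (simp add: nderiv_def)

lemma smooth_has_vector_derivative:
  assumes "smooth f"
  shows "(nderiv n f has_vector_derivative nderiv (Suc n) f x) (at x)"
  using assms by (simp add: smooth_def nderiv_Suc vector_derivative_works)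

text \<open>Two scalars at once make sums, differences and scalar multiples instances of one
  rule.\<close>

lemma nderiv_linear:
  assumes f: "smooth f" and g: "smooth g"
  shows "nderiv n (\<lambda>x. a * f x + b * g x) = (\<lambda>x. a * nderiv n f x + b * nderiv n g x)"
proof (induction n)
  case (Suc n)
  show ?case
    unfolding nderiv_Suc[of n "\<lambda>x. a * f x + b * g x"] Suc
    by (intro ext vector_derivative_at has_vector_derivative_add has_vector_derivative_mult_right
        smooth_has_vector_derivative f g)
qed simp

lemma smooth_linear:
  assumes f: "smooth f" and g: "smooth g"
  shows "smooth (\<lambda>x. a * f x + b * g x)"
  using assms by (auto simp: smooth_def nderiv_linear[OF f g])

lemma schwartz_space_smooth: "f \<in> schwartz_space \<Longrightarrow> smooth f"
  by (simp add: schwartz_space_def)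

lemma schwartz_space_bdd:
  "f \<in> schwartz_space \<Longrightarrow> bdd_above (range (\<lambda>x. (1 + \<bar>x\<bar>) ^ k * norm (nderiv n f x)))"
  by (simp add: schwartz_space_def)

lemma schwartz_space_linear:
  assumes f: "f \<in> schwartz_space" and g: "g \<in> schwartz_space"
  shows "(\<lambda>x. a * f x + b * g x) \<in> schwartz_space"
proof -
  have sm: "smooth f" "smooth g"
    using f g by (auto intro: schwartz_space_smooth)
  have "bdd_above (range (\<lambda>x. (1 + \<bar>x\<bar>) ^ k * norm (nderiv n (\<lambda>x. a * f x + b * g x) x)))" for k n
  proof -
    obtain A where A: "\<And>x. (1 + \<bar>x\<bar>) ^ k * norm (nderiv n f x) \<le> A"
      using schwartz_space_bdd[OF f, of k n] by (auto simp: bdd_above_def)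
    obtain B where B: "\<And>x. (1 + \<bar>x\<bar>) ^ k * norm (nderiv n g x) \<le> B"
      using schwartz_space_bdd[OF g, of k n] by (auto simp: bdd_above_def)
    have "(1 + \<bar>x\<bar>) ^ k * norm (nderiv n (\<lambda>x. a * f x + b * g x) x) \<le> norm a * A + norm b * B" for x
    proof -
      have "(1 + \<bar>x\<bar>) ^ k * norm (nderiv n (\<lambda>x. a * f x + b * g x) x)
          \<le> (1 + \<bar>x\<bar>) ^ k * (norm a * norm (nderiv n f x) + norm b * norm (nderiv n g x))"
        unfolding nderiv_linear[OF sm]
        by (intro mult_left_mono) (auto intro: norm_triangle_le simp: norm_mult)
      also have "\<dots> = norm a * ((1 + \<bar>x\<bar>) ^ k * norm (nderiv n f x)) +
          norm b * ((1 + \<bar>x\<bar>) ^ k * norm (nderiv n g x))"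
        by (simp add: algebra_simps)
      also have "\<dots> \<le> norm a * A + norm b * B"
        by (intro add_mono mult_left_mono A B) auto
      finally show ?thesis .
    qed
    then show ?thesis
      by (auto simp: bdd_above_def)
  qed
  then show ?thesis
    using smooth_linear[OF sm] by (simp add: schwartz_space_def)
qed

section \<open>Point evaluations of derivatives as continuous functionals\<close>

text \<open>The seminorm with weight exponent 0 bounds the \<open>n\<close>-th derivative at every
  point, so the preimage of an open set contains a seminorm ball around each of its members.\<close>

lemma nderiv_eval_in_schwartz_dual: "(\<lambda>f. nderiv n f x) \<in> schwartz_dual"
proof -
  have lin: "nderiv n (\<lambda>x. a * f x + b * g x) x = a * nderiv n f x + b * nderiv n g x"
    if "f \<in> schwartz_space" "g \<in> schwartz_space" for f g a b
    using nderiv_linear[of f g] that by (simp add: schwartz_space_smooth)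
  have "openin schwartz_topology {f \<in> topspace schwartz_topology. nderiv n f x \<in> U}"
    if U: "open U" for U
  proof (subst openin_subopen, intro ballI)
    fix f assume "f \<in> {f \<in> topspace schwartz_topology. nderiv n f x \<in> U}"
    then have f: "f \<in> schwartz_space" and fU: "nderiv n f x \<in> U"
      by (auto simp: topspace_schwartz_topology)
    obtain e where e: "e > 0" and ball: "ball (nderiv n f x) e \<subseteq> U"
      using U fU openE by blast
    define B where "B = {g \<in> schwartz_space. schwartz_seminorm 0 n (\<lambda>x. g x - f x) < e}"
    have "openin schwartz_topology B"
      unfolding schwartz_topology_def B_def using f e by (intro topology_generated_by_Basis) blast
    moreover have "f \<in> B"
    proof -
      \<comment> \<open>The zero function is written as a combination of \<open>f\<close> with
        itself, so that \<open>nderiv_linear\<close> shows its derivatives to vanish; hence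
        \<open>f\<close> has seminorm distance 0 from itself.\<close>
      have "nderiv n (\<lambda>x. 1 * f x + (- 1) * f x) = (\<lambda>x. 0)"
        using f by (subst nderiv_linear) (auto intro: schwartz_space_smooth)
      then show ?thesis
        using f e by (simp add: B_def schwartz_seminorm_def)
    qed
    moreover have "nderiv n g x \<in> U" if "g \<in> B" for g
    proof -
      have g: "g \<in> schwartz_space" and less: "schwartz_seminorm 0 n (\<lambda>x. g x - f x) < e"
        using that by (auto simp: B_def)
      have h: "(\<lambda>x. g x - f x) \<in> schwartz_space"
        using schwartz_space_linear[OF g f, of 1 "-1"] by simp
      have "(1 + \<bar>x\<bar>) ^ 0 * norm (nderiv n (\<lambda>x. g x - f x) x)
          \<le> schwartz_seminorm 0 n (\<lambda>x. g x - f x)"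
        unfolding schwartz_seminorm_def by (intro cSUP_upper schwartz_space_bdd h) simp
      then have "norm (nderiv n g x - nderiv n f x) < e"
        using less lin[OF g f, of 1 "-1"] by simp
      then show ?thesis
        using ball by (auto simp: dist_norm norm_minus_commute)
    qed
    ultimately show "\<exists>T. openin schwartz_topology T \<and> f \<in> T \<and>
        T \<subseteq> {f \<in> topspace schwartz_topology. nderiv n f x \<in> U}"
      by (intro exI[of _ B]) (auto simp: topspace_schwartz_topology B_def)
  qed
  then have "continuous_map schwartz_topology euclidean (\<lambda>f. nderiv n f x)"
    by (auto simp: continuous_map_def)
  moreover have "nderiv n (\<lambda>x. f x + g x) x = nderiv n f x + nderiv n g x"
    if "f \<in> schwartz_space" "g \<in> schwartz_space" for f g
    using lin[OF that, of 1 1] by simp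
  moreover have "nderiv n (\<lambda>x. c * f x) x = c * nderiv n f x" if "f \<in> schwartz_space" for f c
    using lin[OF that that, of c 0] by simp
  ultimately show ?thesis
    by (auto simp: schwartz_dual_def)
qed

lemma continuous_map_weak_schwartz_dual:
  assumes "u \<in> schwartz_dual"
  shows "continuous_map weak_schwartz_topology euclidean u"
proof -
  have "openin weak_schwartz_topology {f \<in> schwartz_space. u f \<in> U}" if "open U" for U
    unfolding weak_schwartz_topology_def using assms that
    by (intro topology_generated_by_Basis) blast
  then show ?thesis
    by (auto simp: continuous_map_def topspace_weak_schwartz_topology)
qed

section \<open>Polynomials times the Gaussian, and interpolation by them\<close>

lemma power_times_gaussian_le:
  fixes x :: real
  shows "(1 + \<bar>x\<bar>) ^ k * exp (- x\<^sup>2) \<le> real (Suc k) ^ Suc k * exp 1"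
proof -
  \<comment> \<open>The exponent is raised by one so that dividing by \<open>n\<close> is legitimate
    also for \<open>k = 0\<close>. This prepares the bound
    \<open>(1 + y / n) ^ n \<le> exp y\<close>.\<close>
  define n where "n = Suc k"
  have n: "n > 0" by (simp add: n_def)
  have "(1 + \<bar>x\<bar>) ^ k \<le> (1 + \<bar>x\<bar>) ^ n"
    unfolding n_def by (intro power_increasing) auto
  also have "\<dots> \<le> (real n * (1 + \<bar>x\<bar> / real n)) ^ n"
    using n by (intro power_mono) (auto simp: field_simps)
  also have "\<dots> = real n ^ n * (1 + \<bar>x\<bar> / real n) ^ n"
    by (simp add: power_mult_distrib)
  also have "\<dots> \<le> real n ^ n * exp \<bar>x\<bar>"
    using n by (intro mult_left_mono exp_ge_one_plus_x_over_n_power_n) auto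
  finally have "(1 + \<bar>x\<bar>) ^ k * exp (- x\<^sup>2) \<le> real n ^ n * exp \<bar>x\<bar> * exp (- x\<^sup>2)"
    by (rule mult_right_mono) simp
  also have "\<dots> = real n ^ n * exp (\<bar>x\<bar> - x\<^sup>2)"
    by (simp add: exp_diff exp_minus field_simps)
  also have "\<dots> \<le> real n ^ n * exp 1"
  proof -
    have "0 \<le> (\<bar>x\<bar> - 1/2)\<^sup>2" by simp
    then have "\<bar>x\<bar> - x\<^sup>2 \<le> 1"
      by (simp add: power2_diff power_divide)
    then show ?thesis
      by (intro mult_left_mono) auto
  qed
  finally show ?thesis by (simp add: n_def)
qed

text \<open>With polynomial factors the family is closed under differentiation, and its coefficients
  are free to prescribe a value and a derivative at a point.\<close>

definition poly_gaussian :: "complex poly \<Rightarrow> real \<Rightarrow> complex" where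
  "poly_gaussian p x = poly p (of_real x) * of_real (exp (- x\<^sup>2))"

lemma poly_gaussian_has_vector_derivative:
  "(poly_gaussian p has_vector_derivative poly_gaussian (pderiv p - [:0, 2:] * p) x) (at x)"
proof -
  \<comment> \<open>The derivative is computed for the entire function of a complex variable and
    then restricted to the real line.\<close>
  have "((\<lambda>z. poly p z * exp (- z\<^sup>2)) has_field_derivative
      (poly (pderiv p) (of_real x) * exp (- (of_real x)\<^sup>2) +
        poly p (of_real x) * (exp (- (of_real x)\<^sup>2) * (- (2 * of_real x))))) (at (of_real x))"
    by (auto intro!: derivative_eq_intros)
  from has_vector_derivative_real_field[OF this] show ?thesis
    unfolding poly_gaussian_def[abs_def]
    by (simp add: algebra_simps exp_of_real[symmetric])
qed

lemma nderiv_poly_gaussian: "\<exists>q. nderiv n (poly_gaussian p) = poly_gaussian q"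
proof (induction n)
  case (Suc n)
  then obtain q where "nderiv n (poly_gaussian p) = poly_gaussian q" ..
  then have "nderiv (Suc n) (poly_gaussian p) = poly_gaussian (pderiv q - [:0, 2:] * q)"
    using poly_gaussian_has_vector_derivative[of q]
    by (auto simp: nderiv_Suc intro!: vector_derivative_at)
  then show ?case ..
qed auto

text \<open>Induction on the coefficients: \<open>pCons a p\<close> is the constant \<open>a\<close>
  plus the variable times \<open>p\<close>, and the extra factor costs one power of the weight.
  Hence \<open>k\<close> is left arbitrary.\<close>

lemma poly_gaussian_rapidly_decreasing:
  "\<exists>C. \<forall>x. (1 + \<bar>x\<bar>) ^ k * norm (poly_gaussian p x) \<le> C"
proof (induction p arbitrary: k)
  case 0
  then show ?case by (auto simp: poly_gaussian_def)
next
  case (pCons a p)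
  obtain C where C: "\<And>x. (1 + \<bar>x\<bar>) ^ Suc k * norm (poly_gaussian p x) \<le> C"
    using pCons.IH by blast
  have "(1 + \<bar>x\<bar>) ^ k * norm (poly_gaussian (pCons a p) x)
      \<le> norm a * (real (Suc k) ^ Suc k * exp 1) + C" for x
  proof -
    have "norm (poly_gaussian (pCons a p) x)
        = norm (a * of_real (exp (- x\<^sup>2)) + of_real x * poly_gaussian p x)"
      by (simp add: poly_gaussian_def algebra_simps)
    also have "\<dots> \<le> norm a * exp (- x\<^sup>2) + (1 + \<bar>x\<bar>) * norm (poly_gaussian p x)"
      by (rule norm_triangle_le, intro add_mono) (auto simp: norm_mult intro: mult_right_mono)
    finally have "(1 + \<bar>x\<bar>) ^ k * norm (poly_gaussian (pCons a p) x)
        \<le> (1 + \<bar>x\<bar>) ^ k * (norm a * exp (- x\<^sup>2) + (1 + \<bar>x\<bar>) * norm (poly_gaussian p x))"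
      by (rule mult_left_mono) simp
    also have "\<dots> = norm a * ((1 + \<bar>x\<bar>) ^ k * exp (- x\<^sup>2)) +
        (1 + \<bar>x\<bar>) ^ Suc k * norm (poly_gaussian p x)"
      by (simp add: algebra_simps)
    also have "\<dots> \<le> norm a * (real (Suc k) ^ Suc k * exp 1) + C"
      by (intro add_mono mult_left_mono power_times_gaussian_le C) auto
    finally show ?thesis .
  qed
  then show ?case by blast
qed

lemma poly_gaussian_schwartz: "poly_gaussian p \<in> schwartz_space"
proof -
  have "nderiv n (poly_gaussian p) differentiable (at x)" for n x
    using nderiv_poly_gaussian[of n p] poly_gaussian_has_vector_derivative
    by (metis differentiableI_vector)
  moreover have "bdd_above (range (\<lambda>x. (1 + \<bar>x\<bar>) ^ k * norm (nderiv n (poly_gaussian p) x)))" for k n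
  proof -
    obtain q where q: "nderiv n (poly_gaussian p) = poly_gaussian q"
      using nderiv_poly_gaussian by blast
    show ?thesis
      using poly_gaussian_rapidly_decreasing[of k q] by (auto simp: q bdd_above_def)
  qed
  ultimately show ?thesis
    by (simp add: schwartz_space_def smooth_def)
qed

lemma schwartz_interpolation:
  obtains g where "g \<in> schwartz_space" "g x = z" "nderiv 1 g x = w"
proof -
  define e :: complex where "e = of_real (exp (- x\<^sup>2))"
  have e: "e \<noteq> 0" by (simp add: e_def)
  \<comment> \<open>The linear polynomial \<open>p\<close> below takes the value
    \<open>z / e\<close> at \<open>x\<close> and has slope \<open>b\<close>. The product rule gives
    the derivative \<open>(b - 2 * x * (z / e)) * e\<close> at \<open>x\<close>, and equating this
    to \<open>w\<close> determines \<open>b\<close>.\<close>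
  define b where "b = w / e + 2 * of_real x * (z / e)"
  define p where "p = [:z / e - b * of_real x, b:]"
  show thesis
  proof
    show "poly_gaussian p \<in> schwartz_space"
      by (rule poly_gaussian_schwartz)
    show "poly_gaussian p x = z"
      using e by (simp add: poly_gaussian_def p_def flip: e_def)
    have "nderiv 1 (poly_gaussian p) x = poly_gaussian (pderiv p - [:0, 2:] * p) x"
      using poly_gaussian_has_vector_derivative[of p x]
      by (simp add: nderiv_Suc vector_derivative_at)
    also have "\<dots> = (b - 2 * of_real x * (z / e)) * e"
      by (simp add: poly_gaussian_def p_def pderiv_pCons algebra_simps flip: e_def)
    also have "\<dots> = w"
      using e by (simp add: b_def)
    finally show "nderiv 1 (poly_gaussian p) x = w" .
  qed
qed

section \<open>Values and first derivatives along the orbit\<close>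

text \<open>Density in closed-set form, so that a proper closed subset of C^2 containing all pairs
  refutes supercyclicity. The preimage of \<open>C\<close> under the pair map is weakly closed and
  contains the scaled orbit, hence is the whole Schwartz space; by interpolation the pair map is
  onto C^2.\<close>

lemma weakly_supercyclic_jets:
  assumes "weakly_supercyclic T"
  obtains f where "\<And>n. (T ^^ n) f \<in> schwartz_space"
    and "\<And>C x. \<lbrakk>closed C; \<And>c n. n \<ge> 1 \<Longrightarrow> (c * (T ^^ n) f x, c * nderiv 1 ((T ^^ n) f) x) \<in> C\<rbrakk>
           \<Longrightarrow> C = UNIV"
proof -
  obtain f where f: "f \<in> schwartz_space"
    and cont: "continuous_map schwartz_topology schwartz_topology T"
    and dense: "weak_schwartz_topology closure_of {(\<lambda>x. c * (T ^^ n) f x) | c n. n \<ge> 1} = schwartz_space"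
    using assms by (auto simp: weakly_supercyclic_def)
  have iter: "(T ^^ n) f \<in> schwartz_space" for n
  proof (induction n)
    case (Suc n)
    then show ?case
      using continuous_map_image_subset_topspace[OF cont]
      by (auto simp: topspace_schwartz_topology)
  qed (use f in simp)
  have "C = UNIV"
    if C: "closed C"
      and orbit: "\<And>c n. n \<ge> 1 \<Longrightarrow> (c * (T ^^ n) f x, c * nderiv 1 ((T ^^ n) f) x) \<in> C" for C x
  proof -
    define J where "J = (\<lambda>g :: real \<Rightarrow> complex. (g x, nderiv 1 g x))"
    define K where "K = {g \<in> topspace weak_schwartz_topology. J g \<in> C}"
    have "continuous_map weak_schwartz_topology (prod_topology euclidean euclidean) J"
      unfolding J_def
      using continuous_map_weak_schwartz_dual[OF nderiv_eval_in_schwartz_dual, of 0 x]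
        continuous_map_weak_schwartz_dual[OF nderiv_eval_in_schwartz_dual, of 1 x]
      by (intro continuous_map_pairedI) simp_all
    then have "closedin weak_schwartz_topology K"
      unfolding K_def using C
      by (intro closedin_continuous_map_preimage) (auto simp: euclidean_product_topology)
    moreover have "{(\<lambda>x. c * (T ^^ n) f x) | c n. n \<ge> 1} \<subseteq> K"
    proof clarify
      fix c and n :: nat assume n: "n \<ge> 1"
      have S: "(\<lambda>x. c * (T ^^ n) f x) \<in> schwartz_space"
        using schwartz_space_linear[OF iter[of n] iter[of n], of c 0] by simp
      have "nderiv 1 (\<lambda>x. c * (T ^^ n) f x) x = c * nderiv 1 ((T ^^ n) f) x"
        using nderiv_eval_in_schwartz_dual[of 1 x] iter[of n] unfolding schwartz_dual_def by blast
      then show "(\<lambda>x. c * (T ^^ n) f x) \<in> K"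
        using S orbit[OF n, of c] by (simp add: K_def J_def topspace_weak_schwartz_topology)
    qed
    ultimately have "schwartz_space \<subseteq> K"
      unfolding dense[symmetric] by (intro closure_of_minimal)
    show "C = UNIV"
    proof (intro equalityI subset_UNIV subsetI, safe)
      fix z w
      obtain g where "g \<in> schwartz_space" "g x = z" "nderiv 1 g x = w"
        by (rule schwartz_interpolation)
      then show "(z, w) \<in> C"
        using \<open>schwartz_space \<subseteq> K\<close> by (auto simp: K_def J_def)
    qed
  qed
  from that[OF iter this] show thesis .
qed

section \<open>Obstructions at critical points and fixed points\<close>

lemma nderiv_1_weighted_composition:
  assumes "smooth \<psi>" "smooth h" and "(\<phi> has_real_derivative d) (at x)"
  shows "nderiv 1 (weighted_composition \<psi> \<phi> h) x
    = nderiv 1 \<psi> x * h (\<phi> x) + \<psi> x * (of_real d * nderiv 1 h (\<phi> x))"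
proof -
  have "((h \<circ> \<phi>) has_vector_derivative d *\<^sub>R nderiv 1 h (\<phi> x)) (at x)"
    using smooth_has_vector_derivative[OF assms(2), of 0] assms(3)
    by (intro vector_diff_chain_at) (auto simp: has_real_derivative_iff_has_vector_derivative)
  from has_vector_derivative_mult[OF _ this] smooth_has_vector_derivative[OF assms(1), of 0 x]
  have "(weighted_composition \<psi> \<phi> h has_vector_derivative
      \<psi> x * (d *\<^sub>R nderiv 1 h (\<phi> x)) + nderiv 1 \<psi> x * h (\<phi> x)) (at x)"
    by (simp add: weighted_composition_def[abs_def] o_def)
  then show ?thesis
    by (simp add: nderiv_Suc vector_derivative_at scaleR_conv_of_real)
qed

text \<open>If \<open>d = 0\<close>, the chain rule term drops out. Value and derivative of an
  iterate at \<open>x\<close> are then \<open>\<psi> x\<close> and \<open>nderiv 1 \<psi> x\<close>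
  times one common number, so all pairs lie on one complex line or at the origin.\<close>

lemma weakly_supercyclic_no_critical_point:
  assumes \<psi>: "smooth \<psi>" and sup: "weakly_supercyclic (weighted_composition \<psi> \<phi>)"
    and d: "(\<phi> has_real_derivative d) (at x)"
  shows "d \<noteq> 0"
proof
  assume "d = 0"
  define T where "T = weighted_composition \<psi> \<phi>"
  obtain f where iter: "\<And>n. (T ^^ n) f \<in> schwartz_space"
    and jets: "\<And>C x. \<lbrakk>closed C;
        \<And>c n. n \<ge> 1 \<Longrightarrow> (c * (T ^^ n) f x, c * nderiv 1 ((T ^^ n) f) x) \<in> C\<rbrakk> \<Longrightarrow> C = UNIV"
    using weakly_supercyclic_jets[OF sup[folded T_def]] by metis
  \<comment> \<open>Only \<open>n \<ge> 1\<close> is covered: \<open>f\<close> itself satisfies no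
    such relation, which is harmless because orbits start with the first iterate.\<close>
  have *: "(T ^^ n) f x = \<psi> x * (T ^^ (n - 1)) f (\<phi> x)"
    "nderiv 1 ((T ^^ n) f) x = nderiv 1 \<psi> x * (T ^^ (n - 1)) f (\<phi> x)" if n: "n \<ge> 1" for n
  proof -
    obtain m where n: "n = Suc m"
      using n by (metis not0_implies_Suc not_one_le_zero)
    have "smooth ((T ^^ m) f)"
      using iter by (rule schwartz_space_smooth)
    then show "nderiv 1 ((T ^^ n) f) x = nderiv 1 \<psi> x * (T ^^ (n - 1)) f (\<phi> x)"
      using nderiv_1_weighted_composition[OF \<psi> _ d, of "(T ^^ m) f"] \<open>d = 0\<close> by (simp add: T_def n)
    show "(T ^^ n) f x = \<psi> x * (T ^^ (n - 1)) f (\<phi> x)"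
      by (simp add: n T_def weighted_composition_def)
  qed
  have "{p. nderiv 1 \<psi> x * fst p = \<psi> x * snd p} = UNIV"
    by (intro jets[where x = x] closed_Collect_eq continuous_intros) (auto simp: *[unfolded One_nat_def])
  then have "nderiv 1 \<psi> x * z = \<psi> x * w" for z w
    by (auto simp: set_eq_iff)
  \<comment> \<open>The pair \<open>(0, 1)\<close> must satisfy the relation, which forces
    \<open>\<psi> x = 0\<close>. Then every iterate vanishes at \<open>x\<close>, and the closed set
    of pairs with first entry 0 gives the contradiction.\<close>
  from this[of 0 1] have "\<psi> x = 0" by simp
  have "{p :: complex \<times> complex. fst p = 0} = UNIV"
    by (intro jets[where x = x] closed_Collect_eq continuous_intros) (auto simp: *[unfolded One_nat_def] \<open>\<psi> x = 0\<close>)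
  then have "(1 :: complex, 0 :: complex) \<in> {p. fst p = 0}"
    by blast
  then show False by simp
qed

text \<open>At a fixed point, the logarithmic derivative of the iterates evolves under an affine map
  with real slope \<^term>\<open>d\<close>, so it never leaves a real line in the complex plane.\<close>

lemma weakly_supercyclic_no_fixed_point:
  assumes \<psi>: "smooth \<psi>" and sup: "weakly_supercyclic (weighted_composition \<psi> \<phi>)"
    and d: "(\<phi> has_real_derivative d) (at x)"
  shows "\<phi> x \<noteq> x"
proof
  assume fixed: "\<phi> x = x"
  define T where "T = weighted_composition \<psi> \<phi>"
  obtain f where iter: "\<And>n. (T ^^ n) f \<in> schwartz_space"
    and jets: "\<And>C x. \<lbrakk>closed C;
        \<And>c n. n \<ge> 1 \<Longrightarrow> (c * (T ^^ n) f x, c * nderiv 1 ((T ^^ n) f) x) \<in> C\<rbrakk> \<Longrightarrow> C = UNIV"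
    using weakly_supercyclic_jets[OF sup[folded T_def]] by metis
  have val: "(T ^^ n) f x = \<psi> x ^ n * f x" for n
    by (induction n) (simp_all add: T_def weighted_composition_def fixed)
  have der: "nderiv 1 ((T ^^ Suc n) f) x
      = nderiv 1 \<psi> x * (\<psi> x ^ n * f x) + \<psi> x * (of_real d * nderiv 1 ((T ^^ n) f) x)" for n
  proof -
    have "smooth ((T ^^ n) f)"
      using iter by (rule schwartz_space_smooth)
    from nderiv_1_weighted_composition[OF \<psi> this d] show ?thesis
      using val[of n] by (simp add: T_def fixed)
  qed
  \<comment> \<open>Otherwise \<open>\<psi> x ^ n * f x\<close> vanishes for all
    \<open>n \<ge> 1\<close>, so every pair has first entry 0.\<close>
  have nz: "\<psi> x \<noteq> 0 \<and> f x \<noteq> 0"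
  proof (rule ccontr)
    assume "\<not> ?thesis"
    then have "{p :: complex \<times> complex. fst p = 0} = UNIV"
      by (intro jets[where x = x] closed_Collect_eq continuous_intros) (auto simp: val)
    then have "(1 :: complex, 0 :: complex) \<in> {p. fst p = 0}"
      by blast
    then show False by simp
  qed
  \<comment> \<open>\<open>r\<close> is the logarithmic derivative of \<open>f\<close> at
    \<open>x\<close>, and \<open>e\<close> is its change under one application of \<open>T\<close>.
    The offset from \<open>r\<close> evolves by \<open>y \<mapsto> e + d * y\<close>, so it stays in
    the real multiples of \<open>e\<close>. The default 1 for \<open>u\<close> when
    \<open>e = 0\<close> keeps the direction nonzero.\<close>
  define r where "r = nderiv 1 f x / f x"
  define e where "e = nderiv 1 \<psi> x / \<psi> x + (of_real d - 1) * r"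
  define u where "u = (if e = 0 then 1 else e)"
  have line: "\<exists>s :: real. nderiv 1 ((T ^^ n) f) x = \<psi> x ^ n * f x * (r + of_real s * u)" for n
  proof (induction n)
    case 0
    show ?case
      using nz by (intro exI[of _ 0]) (simp add: r_def)
  next
    case (Suc n)
    then obtain s :: real where
      s: "nderiv 1 ((T ^^ n) f) x = \<psi> x ^ n * f x * (r + of_real s * u)" ..
    obtain t :: real where t: "e = of_real t * u"
    proof (cases "e = 0")
      case True
      then show thesis by (intro that[of 0]) simp
    next
      case False
      then show thesis by (intro that[of 1]) (simp add: u_def)
    qed
    have \<psi>': "nderiv 1 \<psi> x = \<psi> x * (e - (of_real d - 1) * r)"
      using nz by (simp add: e_def)
    have "nderiv 1 ((T ^^ Suc n) f) x
        = \<psi> x ^ Suc n * f x * (r + e + of_real d * (of_real s * u))"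
      unfolding der s \<psi>' by (simp add: algebra_simps)
    also have "r + e + of_real d * (of_real s * u) = r + of_real (t + d * s) * u"
      by (simp add: t algebra_simps)
    finally show ?case by blast
  qed
  \<comment> \<open>For a nonzero first entry the condition says that
    \<open>(snd p / fst p - r) / u\<close> is real. Clearing denominators makes it continuous on all
    of C^2, so that it defines a closed set.\<close>
  have "{p. Im ((snd p - r * fst p) * cnj (fst p * u)) = 0} = UNIV"
  proof (intro jets[where x = x] closed_Collect_eq continuous_intros)
    fix c and n :: nat
    obtain s :: real where
      s: "nderiv 1 ((T ^^ n) f) x = \<psi> x ^ n * f x * (r + of_real s * u)"
      using line by blast
    define z where "z = c * (\<psi> x ^ n * f x) * u"
    have "(c * nderiv 1 ((T ^^ n) f) x - r * (c * (T ^^ n) f x)) * cnj (c * (T ^^ n) f x * u)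
        = of_real s * (z * cnj z)"
      unfolding s val z_def by (simp add: algebra_simps)
    also have "\<dots> = of_real (s * (norm z)\<^sup>2)"
      by (simp only: complex_norm_square of_real_mult)
    finally show "(c * (T ^^ n) f x, c * nderiv 1 ((T ^^ n) f) x)
        \<in> {p. Im ((snd p - r * fst p) * cnj (fst p * u)) = 0}"
      by (simp only: mem_Collect_eq fst_conv snd_conv Im_complex_of_real)
  qed
  \<comment> \<open>This pair is offset from \<open>r\<close> perpendicularly to the line; the
    imaginary part there is the squared norm of \<open>u\<close>.\<close>
  then have "(1, r + \<i> * u) \<in> {p. Im ((snd p - r * fst p) * cnj (fst p * u)) = 0}"
    by blast
  then have "Im (\<i> * (u * cnj u)) = 0"
    by (simp add: mult.assoc)
  then have "Im (\<i> * of_real ((norm u)\<^sup>2)) = 0"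
    by (simp only: complex_norm_square)
  then have "u = 0" by simp
  then show False
    by (simp add: u_def split: if_splits)
qed

section \<open>Real roots of polynomials and the conclusion\<close>

text \<open>A polynomial of odd degree has opposite signs far to the left and far to the right, so
  the intermediate value theorem applies. Negation reduces to a positive leading
  coefficient.\<close>

lemma odd_degree_real_poly_root:
  fixes p :: "real poly"
  assumes "odd (degree p)"
  shows "\<exists>x. poly p x = 0"
proof -
  have pos: "\<exists>x. poly p x = 0" if odd: "odd (degree p)" and lc: "lead_coeff p > 0" for p :: "real poly"
  proof -
    \<comment> \<open>The reflection \<open>q x = - p (- x)\<close> again has positive leading
      coefficient because the degree is odd, so positivity of \<open>q\<close> near plus infinity
      yields negativity of \<open>p\<close> near minus infinity.\<close>
    define q where "q = - pcompose p [:0, -1:]"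
    have "lead_coeff q = - (lead_coeff p * (-1) ^ degree p)"
      unfolding q_def lead_coeff_minus by (subst lead_coeff_comp) simp_all
    then have "lead_coeff q > 0"
      using odd lc by simp
    then obtain m where m: "\<And>x. x \<ge> m \<Longrightarrow> poly q x > 0"
      using poly_pinfty_gt_lc[of q] by (meson less_le_trans)
    obtain n where n: "\<And>x. x \<ge> n \<Longrightarrow> poly p x > 0"
      using poly_pinfty_gt_lc[OF lc] lc by (meson less_le_trans)
    define k where "k = max 1 (max m n)"
    have "poly q k = - poly p (- k)"
      by (simp add: q_def poly_pcompose)
    then have "poly p (- k) < 0" "poly p k > 0"
      using m[of k] n[of k] by (simp_all add: k_def)
    moreover have "- k < k"
      by (simp add: k_def)
    ultimately show ?thesis
      using poly_IVT_pos by blast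
  qed
  show ?thesis
  proof (cases "lead_coeff p > 0")
    case True
    then show ?thesis using pos assms by blast
  next
    case False
    have "lead_coeff p \<noteq> 0" using assms by auto
    then have "lead_coeff (- p) > 0"
      using False unfolding lead_coeff_minus by linarith
    then have "\<exists>x. poly (- p) x = 0"
      by (intro pos) (use assms in simp_all)
    then show ?thesis by simp
  qed
qed

theorem proposition6p1:
  fixes \<phi> :: "real \<Rightarrow> real"
  assumes "\<exists>p :: real poly. \<phi> = poly p"
    and "\<exists>\<psi> \<in> multiplier_space. weakly_supercyclic (weighted_composition \<psi> \<phi>)"
  shows "\<exists>b. b \<noteq> 0 \<and> \<phi> = (\<lambda>x. x + b)"
proof -
  obtain p where p: "\<phi> = poly p"
    using assms(1) by blast
  obtain \<psi> where \<psi>: "smooth \<psi>" and sup: "weakly_supercyclic (weighted_composition \<psi> \<phi>)"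
    using assms(2) by (auto simp: multiplier_space_def)
  have der: "(\<phi> has_real_derivative poly (pderiv p) x) (at x)" for x
    unfolding p by (rule poly_DERIV)
  have crit: "poly (pderiv p) x \<noteq> 0" for x
    by (rule weakly_supercyclic_no_critical_point[OF \<psi> sup der])
  have fix_free: "poly (p - [:0, 1:]) x \<noteq> 0" for x
    using weakly_supercyclic_no_fixed_point[OF \<psi> sup der, of x] by (simp add: p)
  have "degree p \<le> 1"
  proof (rule ccontr)
    assume deg: "\<not> degree p \<le> 1"
    \<comment> \<open>Subtracting the identity leaves a degree of at least 2 unchanged, while
      differentiation lowers it by one; the two degrees have opposite parity.\<close>
    have "degree (p - [:0, 1:]) = degree p"
      using deg unfolding diff_conv_add_uminus by (intro degree_add_eq_left) simp
    then have "even (degree p)"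
      using odd_degree_real_poly_root[of "p - [:0, 1:]"] fix_free by auto
    moreover have "even (degree p - 1)"
      using odd_degree_real_poly_root[of "pderiv p"] crit by (auto simp: degree_pderiv)
    ultimately show False
      using deg by simp
  qed
  obtain b q where q: "p = pCons b q"
    by (rule pCons_cases)
  with \<open>degree p \<le> 1\<close> have "degree q = 0"
    by (simp split: if_splits)
  then obtain a where ab: "p = [:b, a:]"
    using q by (auto elim: degree_eq_zeroE)
  \<comment> \<open>A line of slope other than 1 meets the diagonal, at
    \<open>b / (1 - a)\<close>.\<close>
  have "a = 1"
  proof (rule ccontr)
    assume "a \<noteq> 1"
    then have "poly (p - [:0, 1:]) (b / (1 - a)) = 0"
      by (simp add: ab field_simps)
    then show False using fix_free by blast
  qed
  then have "\<phi> = (\<lambda>x. x + b)"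
    by (auto simp: p ab)
  moreover have "b \<noteq> 0"
    using fix_free[of 0] by (simp add: ab)
  ultimately show ?thesis by blast
qed

end
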